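(* Let $M\in\mathbb{R}^{n\times m}$ be a (left) stochastic matrix with $\operatorname{rank}M=r$. Then \[B_4(M)=\sum_{i=1}^n\max_{1\le j\le m}M(i,j)\le r.\]
   Context: A (left) stochastic matrix has nonnegative entries and each column sums to $1$. $M(i,j)$ denotes the entry in row $i$, column $j$. *)

theory Defs
  imports "HOL-Analysis.Analysis"
begin

(* An n x m real matrix has type real ^ 'm ^ 'n: the entry in row i and column j is M $ i $ j. *)

definition left_stochastic :: "real ^ 'm ^ 'n \<Rightarrow> bool" where
  "left_stochastic M \<longleftrightarrow>
     (\<forall>i j. 0 \<le> M $ i $ j) \<and> (\<forall>j. (\<Sum>i\<in>UNIV. M $ i $ j) = 1)"

definition B4 :: "real ^ 'm ^ 'n \<Rightarrow> real" where
  "B4 M = (\<Sum>i\<in>UNIV. Max (range (\<lambda>j. M $ i $ j)))"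

end

theory Submission
  imports Defs
begin

text \<open>
  Among all bases of the column space that consist of columns of the matrix, one of maximal volume
  expresses every column with coefficients of absolute value at most 1, by Cramer's rule. As the
  entries are nonnegative, each row maximum is then at most the sum of that row's entries over the
  \<open>r\<close> basis columns. Summing over the rows, each basis column contributes exactly 1.
\<close>

lemma row_vec_lambda: "row i (\<chi> i. f i) = f i"
  by (simp add: row_def)

lemma det_rows_spanning_ne_0:
  fixes \<phi> :: "'n::finite \<Rightarrow> real ^ 'n"
  assumes "span (range \<phi>) = UNIV"
  shows "det (\<chi> i. \<phi> i) \<noteq> 0"
proof -
  have "rows (\<chi> i. \<phi> i) = range \<phi>"
    by (auto simp: rows_def row_vec_lambda)
  then show ?thesis
    using assms matrix_left_invertible_span_rows[of "\<chi> i. \<phi> i"]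
    by (metis invertible_det_nz invertible_left_inverse)
qed

text \<open>Independence of \<open>range f\<close> as a set does not see repeated rows, so
  \<open>inj f\<close> is recorded separately; it lets cardinalities of images under
  \<open>f\<close> be counted by indices.\<close>

lemma det_rows_ne_0_imp_independent:
  fixes f :: "'n::finite \<Rightarrow> real ^ 'n"
  assumes "det (\<chi> i. f i) \<noteq> 0"
  shows "inj f" and "independent (range f)"
proof -
  show "inj f"
    using assms det_identical_rows[of _ _ "\<chi> i. f i"] by (metis injI row_vec_lambda)
  have "rows (\<chi> i. f i) = range f"
    by (auto simp: rows_def row_vec_lambda)
  then show "independent (range f)"
    using assms det_dependent_rows[of "\<chi> i. f i"] by (auto simp: dependent_vec_eq)
qed

lemma exists_basis_coefficients_le_1:
  fixes S :: "(real ^ 'n) set"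
  assumes "finite S"
  obtains B where "B \<subseteq> S" "card B = dim S"
    "\<And>v. v \<in> S \<Longrightarrow> \<exists>w. v = (\<Sum>b\<in>B. w b *\<^sub>R b) \<and> (\<forall>b\<in>B. \<bar>w b\<bar> \<le> 1)"
proof -
  obtain B0 where B0: "B0 \<subseteq> S" "independent B0" "S \<subseteq> span B0" "card B0 = dim S"
    by (rule basis_exists)
  \<comment> \<open>\<open>S\<close> may span a proper subspace; completing \<open>B0\<close> to a
    basis of the whole space makes a square determinant available.\<close>
  define E where "E = extend_basis B0"
  have E: "B0 \<subseteq> E" "independent E" "span E = UNIV"
    unfolding E_def using B0(2)
    by (simp_all add: extend_basis_superset independent_extend_basis)
  have "card E = CARD('n)"
    using dim_eq_card_independent[OF E(2)] E(3) dim_span[of E] by simp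
  then obtain \<phi> :: "'n \<Rightarrow> real ^ 'n" where \<phi>: "bij_betw \<phi> UNIV E"
    using finite_same_card_bij[of "UNIV :: 'n set" E] finiteI_independent[OF E(2)] by auto
  define K where "K = {i. \<phi> i \<in> B0}"
  have "bij_betw \<phi> K B0"
    using \<phi> E(1) unfolding K_def bij_betw_def inj_on_def by auto
  then have card_K: "card K = dim S"
    using B0(4) bij_betw_same_card by metis
  \<comment> \<open>The rows outside \<open>K\<close> stay fixed at a complement of \<open>span S\<close>, so that the determinant
    measures volume inside \<open>span S\<close>.\<close>
  define F where "F = Pi\<^sub>E UNIV (\<lambda>i. if i \<in> K then S else {\<phi> i})"
  have "finite F"
    unfolding F_def using assms by (intro finite_PiE) auto
  moreover have \<phi>F: "\<phi> \<in> F"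
    using B0(1) by (auto simp: F_def K_def PiE_UNIV_domain)
  ultimately obtain f where f: "f \<in> F"
    and max: "\<And>g. g \<in> F \<Longrightarrow> \<bar>det (\<chi> i. g i)\<bar> \<le> \<bar>det (\<chi> i. f i)\<bar>"
    using ex_is_arg_min_if_finite[of F "\<lambda>g. - \<bar>det (\<chi> i. g i)\<bar>"]
    by (auto simp: is_arg_min_linorder)
  have "det (\<chi> i. \<phi> i) \<noteq> 0"
    using \<phi> E(3) by (intro det_rows_spanning_ne_0) (simp add: bij_betw_def)
  \<comment> \<open>The maximum is at least the nonzero value at \<open>\<phi>\<close>, so the
    maximiser again has independent rows.\<close>
  then have det_f: "det (\<chi> i. f i) \<noteq> 0"
    using max[OF \<phi>F] by auto
  note indep = det_rows_ne_0_imp_independent[OF det_f]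
  have inj: "inj_on f K"
    using indep(1) by (rule inj_on_subset) simp
  have sub: "f ` K \<subseteq> S"
    using f by (auto simp: F_def PiE_UNIV_domain Pi_iff split: if_splits)
  have card: "card (f ` K) = dim S"
    using card_image[OF inj] card_K by simp
  have "independent (f ` K)"
    using indep(2) by (rule independent_mono) auto
  then have span: "S \<subseteq> span (f ` K)"
    using card_ge_dim_independent[OF sub] card by simp
  show thesis
  proof (rule that[OF sub card])
    fix v assume v: "v \<in> S"
    then have "v \<in> span (f ` K)"
      using span by blast
    then obtain w where w: "v = (\<Sum>b\<in>f ` K. w b *\<^sub>R b)"
      by (auto simp: span_finite)
    have "\<bar>w (f k)\<bar> \<le> 1" if k: "k \<in> K" for k
    proof -
      \<comment> \<open>Coordinates of \<open>v\<close> with respect to all rows of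
        \<open>f\<close>: they vanish off \<open>K\<close> because \<open>v\<close> lies in the span
        of the rows indexed by \<open>K\<close>.\<close>
      define x :: "real ^ 'n" where "x = (\<chi> i. if i \<in> K then w (f i) else 0)"
      have "v = (\<Sum>i\<in>K. w (f i) *\<^sub>R f i)"
        using w by (simp add: sum.reindex[OF inj])
      also have "\<dots> = (\<Sum>i\<in>UNIV. x $ i *s f i)"
        by (rule sum.mono_neutral_cong_left) (auto simp: x_def scalar_mult_eq_scaleR)
      finally have v_eq: "v = (\<Sum>i\<in>UNIV. x $ i *s f i)" .
      \<comment> \<open>Cramer's rule: exchanging row \<open>k\<close> for \<open>v\<close> scales
        the determinant by \<open>x $ k\<close>. Since \<open>k \<in> K\<close> and
        \<open>v \<in> S\<close>, the exchange stays in \<open>F\<close>, so maximality bounds this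
        factor.\<close>
      have "det (\<chi> i. (f(k := v)) i) = x $ k * det (\<chi> i. f i)"
        using cramer_lemma_transpose[of k x "\<chi> i. f i"]
        unfolding row_vec_lambda v_eq[symmetric] fun_upd_def .
      moreover have "f(k := v) \<in> F"
        using f v k unfolding F_def PiE_UNIV_domain Pi_iff by (metis UNIV_I fun_upd_apply)
      ultimately have "\<bar>x $ k\<bar> * \<bar>det (\<chi> i. f i)\<bar> \<le> 1 * \<bar>det (\<chi> i. f i)\<bar>"
        using max by (metis abs_mult mult_1)
      then have "\<bar>x $ k\<bar> \<le> 1"
        using det_f by (simp add: mult_le_cancel_right_pos)
      then show ?thesis
        using k by (simp add: x_def)
    qed
    then show "\<exists>w. v = (\<Sum>b\<in>f ` K. w b *\<^sub>R b) \<and> (\<forall>b\<in>f ` K. \<bar>w b\<bar> \<le> 1)"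
      using w by blast
  qed
qed

theorem theorem3:
  fixes M :: "real ^ 'm ^ 'n" and r :: nat
  assumes "left_stochastic M"
    and "rank M = r"
  shows "B4 M \<le> real r"
proof -
  have columns: "columns M = range (\<lambda>j. column j M)"
    by (auto simp: columns_def)
  then have "finite (columns M)"
    by simp
  then obtain B where B: "B \<subseteq> columns M" "card B = dim (columns M)"
    and coeff: "\<And>v. v \<in> columns M \<Longrightarrow> \<exists>w. v = (\<Sum>b\<in>B. w b *\<^sub>R b) \<and> (\<forall>b\<in>B. \<bar>w b\<bar> \<le> 1)"
    using exists_basis_coefficients_le_1 by blast
  have nonneg: "0 \<le> b $ i" and sum_1: "(\<Sum>i\<in>UNIV. b $ i) = 1" if "b \<in> B" for b i
    using that B(1) assms(1) unfolding columns by (auto simp: left_stochastic_def column_def)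
  \<comment> \<open>The bound does not depend on \<open>j\<close>, so it passes to the maximum of
    row \<open>i\<close>.\<close>
  have "M $ i $ j \<le> (\<Sum>b\<in>B. b $ i)" for i j
  proof -
    obtain w where w: "column j M = (\<Sum>b\<in>B. w b *\<^sub>R b)" "\<And>b. b \<in> B \<Longrightarrow> \<bar>w b\<bar> \<le> 1"
      using coeff[of "column j M"] columns by auto
    have "M $ i $ j = column j M $ i"
      by (simp add: column_def)
    also have "\<dots> = (\<Sum>b\<in>B. w b * b $ i)"
      by (simp add: w(1))
    \<comment> \<open>Termwise, by \<open>w b \<le> 1\<close> and \<open>0 \<le> b $ i\<close>;
      negative coefficients only lower the left side.\<close>
    also have "\<dots> \<le> (\<Sum>b\<in>B. b $ i)"
    proof (rule sum_mono)
      fix b assume b: "b \<in> B"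
      then have "w b \<le> 1"
        using w(2) by fastforce
      then show "w b * b $ i \<le> b $ i"
        using mult_right_mono[of "w b" 1 "b $ i"] nonneg[OF b] by simp
    qed
    finally show ?thesis .
  qed
  then have "B4 M \<le> (\<Sum>i\<in>UNIV. \<Sum>b\<in>B. b $ i)"
    unfolding B4_def by (intro sum_mono) (auto intro!: Max.boundedI)
  also have "\<dots> = (\<Sum>b\<in>B. \<Sum>i\<in>UNIV. b $ i)"
    by (rule sum.swap)
  also have "\<dots> = real r"
    using sum_1 B(2) assms(2) by (simp add: column_rank_def)
  finally show ?thesis .
qed

end
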